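(* Let $\mathfrak{g}=\mathrm{span}(p^0,L_1,L_2,L_3)$ be the Lie algebra of the symmetry group $\mathbb{R}\times SO(3)$ of a non-rotating black hole, generated by the vector fields $p^0=\partial_t$ and $L_i=\epsilon_{ijk}x^j\partial_k$, given in Cartesian coordinates $(t,x^1,x^2,x^3)$, and let $r=\|\mathbf{x}\|$. (1) In order to fulfill $[V_a,\mathfrak{g}]\subseteq\mathfrak{g}$, each vector field $V_a$ has to be of the form $$V_a=(c_a^0(r)+N_a^0t)\,\partial_t+d_a^iL_i+f_a(r)\,x^i\partial_i$$ with constants $N_a^0,d_a^i$ and functions $c_a^0,f_a$ of $r$. (2) For vector fields $V_a$, $V_b$ of this form, the requirement $[V_a,V_b]=0$ amounts to the conditions $$d_a^id_b^j\epsilon_{ijk}=0\ \ \forall k,$$ $$(f_a(r)x^j\partial_j-N_a^0)c_b^0(r)-(f_b(r)x^j\partial_j-N_b^0)c_a^0(r)=0,$$ $$f_a(r)f_b'(r)-f_a'(r)f_b(r)=0.$$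
   Context: Repeated spatial indices are summed over $1,2,3$; $\epsilon_{ijk}$ is the Levi-Civita symbol; $\partial_i=\partial/\partial x^i$; $\|\cdot\|$ is the Euclidean norm of the spatial position vector; a prime denotes $d/dr$; $[\cdot,\cdot]$ is the Lie bracket of vector fields. The vector fields $V_a$ are real vector fields on the four-dimensional spacetime, used to build a twist $\exp\bigl(-\frac{i\lambda}{2}\theta^{ab}V_a\otimes V_b\bigr)$ with $\theta$ constant and antisymmetric, for which they must mutually commute. *)

theory Defs
  imports "HOL-Analysis.Analysis"
begin

text \<open>Spacetime points are pairs $(t, x)$ in Cartesian coordinates; a vector field is given by its
  components $(V^0, (V^1, V^2, V^3))$ with respect to the coordinate basis.\<close>

type_synonym spacetime = "real \<times> (real ^ 3)"
type_synonym vector_field = "spacetime \<Rightarrow> spacetime"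

text \<open>A spherically symmetric piece of spacetime, cut out by a set of admissible radii: all of
  it for \<open>R = UNIV\<close>, the part away from the central world line for \<open>R = {0<..}\<close>, an exterior
  region for \<open>R = {r0<..}\<close>. Negative elements of \<open>R\<close> play no role.\<close>

definition region :: "real set \<Rightarrow> spacetime set"
  where "region R = {p. norm (snd p) \<in> R}"

text \<open>$C^k$ and $C^\infty$ on an open set.\<close>

primrec Ck_on :: "nat \<Rightarrow> 'a::euclidean_space set \<Rightarrow> ('a \<Rightarrow> 'b::real_normed_vector) \<Rightarrow> bool" where
  "Ck_on 0 S f \<longleftrightarrow> continuous_on S f"
| "Ck_on (Suc k) S f \<longleftrightarrow>
     (\<forall>x\<in>S. f differentiable (at x)) \<and>
     (\<forall>v. Ck_on k S (\<lambda>x. frechet_derivative f (at x) v))"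

definition smooth_on :: "'a::euclidean_space set \<Rightarrow> ('a \<Rightarrow> 'b::real_normed_vector) \<Rightarrow> bool"
  where "smooth_on S f \<longleftrightarrow> (\<forall>k. Ck_on k S f)"

text \<open>$[V,W]^\mu = V^\nu \partial_\nu W^\mu - W^\nu \partial_\nu V^\mu$.\<close>

definition lie_bracket :: "vector_field \<Rightarrow> vector_field \<Rightarrow> vector_field"
  where "lie_bracket V W p =
    frechet_derivative W (at p) (V p) - frechet_derivative V (at p) (W p)"

definition levi_civita :: "3 \<Rightarrow> 3 \<Rightarrow> 3 \<Rightarrow> real"
  where "levi_civita i j k =
    (if (i, j, k) \<in> {(1, 2, 3), (2, 3, 1), (3, 1, 2)} then 1
     else if (i, j, k) \<in> {(3, 2, 1), (2, 1, 3), (1, 3, 2)} then -1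
     else 0)"

definition d_t :: vector_field
  where "d_t p = (1, 0)"

definition d_x :: "3 \<Rightarrow> vector_field"
  where "d_x k p = (0, axis k 1)"

definition rot :: "3 \<Rightarrow> vector_field"
  where "rot i p = (\<Sum>j\<in>UNIV. \<Sum>k\<in>UNIV. (levi_civita i j k * snd p $ j) *\<^sub>R d_x k p)"

text \<open>The real span of $p^0 = \partial_t$ and $L_1, L_2, L_3$.\<close>

definition bh_algebra :: "vector_field set"
  where "bh_algebra = {X. \<exists>(a::real) (b::real ^ 3).
    \<forall>p. X p = a *\<^sub>R d_t p + (\<Sum>i\<in>UNIV. (b $ i) *\<^sub>R rot i p)}"

text \<open>$[V, \mathfrak{g}] \subseteq \mathfrak{g}$, as vector fields on \<open>region R\<close>.\<close>

definition bracket_into_bh_algebra :: "real set \<Rightarrow> vector_field \<Rightarrow> bool"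
  where "bracket_into_bh_algebra R V \<longleftrightarrow>
    (\<forall>X\<in>bh_algebra. \<exists>Y\<in>bh_algebra. \<forall>p\<in>region R. lie_bracket V X p = Y p)"

text \<open>$V = (c(r) + N t)\,\partial_t + d^i L_i + f(r)\, x^i \partial_i$ on \<open>region R\<close>.
  Smoothness of the coefficient functions is only asked for at positive radii: $r$ itself is not
  smooth at the origin, where moreover the value of $f$ is immaterial.\<close>

definition has_bh_form ::
    "real set \<Rightarrow> vector_field \<Rightarrow> (real \<Rightarrow> real) \<Rightarrow> real \<Rightarrow> real ^ 3 \<Rightarrow> (real \<Rightarrow> real) \<Rightarrow> bool"
  where "has_bh_form R V c N d f \<longleftrightarrow>
    smooth_on (R \<inter> {0<..}) c \<and> smooth_on (R \<inter> {0<..}) f \<and>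
    (\<forall>p\<in>region R. V p =
       (c (norm (snd p)) + N * fst p) *\<^sub>R d_t p
       + (\<Sum>i\<in>UNIV. (d $ i) *\<^sub>R rot i p)
       + (\<Sum>i\<in>UNIV. (f (norm (snd p)) * snd p $ i) *\<^sub>R d_x i p))"

text \<open>$x^j \partial_j$ applied to the spatial function $x \mapsto c(\|x\|)$; at the origin the factor
  $x^j$ makes this $0$.\<close>

definition euler_radial :: "(real \<Rightarrow> real) \<Rightarrow> real ^ 3 \<Rightarrow> real"
  where "euler_radial c x =
    (\<Sum>j\<in>UNIV. x $ j * frechet_derivative (\<lambda>y. c (norm y)) (at x) (axis j 1))"

end

theory Submission
  imports Defs
begin

text \<open>Write \<open>L\<^sub>w\<close> for the rotation field \<open>x \<mapsto> w \<times> x\<close>. If \<open>[V, L\<^sub>w] = A w \<partial>\<^sub>t + L\<^bsub>B w\<^esub>\<close> with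
  \<open>A\<close>, \<open>B\<close> linear, evaluation at \<open>x = w\<close> gives \<open>A = 0\<close> and \<open>x \<times> v = B x \<times> x\<close> for the spatial part \<open>v\<close>
  of \<open>V\<close>; hence \<open>v = - B x + \<lambda> x\<close>. Differentiating \<open>x \<times> (v + B x) = 0\<close> along a rotation shows that
  \<open>B\<close> is antisymmetric, so \<open>- B x\<close> is a rotation field. The functions \<open>V\<^sup>0\<close> and \<open>x \<bullet> v\<close> are annihilated
  by all rotations and therefore radial; the bracket with \<open>\<partial>\<^sub>t\<close> gives the dependence on \<open>t\<close>. For two fields of
  the resulting form, the radial and the tangential spatial part and the time part of the bracket
  vanish separately.\<close>

section \<open>Calculus of \<open>Ck_on\<close> functions on open sets\<close>

lemma Ck_on_cong:
  assumes "open S" "\<And>x. x \<in> S \<Longrightarrow> f x = g x" "Ck_on k S f"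
  shows "Ck_on k S g"
  using assms(2,3)
proof (induction k arbitrary: f g)
  case 0
  then show ?case by (metis Ck_on.simps(1) continuous_on_cong)
next
  case (Suc k)
  have D: "(g has_derivative frechet_derivative f (at x)) (at x)" if "x \<in> S" for x
    using that Suc.prems has_derivative_transform_within_open[OF _ assms(1)]
    by (metis Ck_on.simps(2) frechet_derivative_works)
  then have "frechet_derivative f (at x) = frechet_derivative g (at x)" if "x \<in> S" for x
    using frechet_derivative_at that by blast
  then have "Ck_on k S (\<lambda>x. frechet_derivative g (at x) v)" for v
    using Suc.IH[of "\<lambda>x. frechet_derivative f (at x) v"] Suc.prems(2) by simp
  with D show ?case by (auto simp: differentiable_def)
qed

text \<open>Replaces the opaque \<open>frechet_derivative\<close> by an explicit derivative, so that
  the closure properties below become inductions on the order with the usual differentiation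
  rules.\<close>

lemma Ck_on_SucI:
  assumes "open S" "\<And>x. x \<in> S \<Longrightarrow> (f has_derivative f' x) (at x)"
    "\<And>v. Ck_on k S (\<lambda>x. f' x v)"
  shows "Ck_on (Suc k) S f"
proof -
  have "f' x = frechet_derivative f (at x)" if "x \<in> S" for x
    using assms(2)[OF that] by (rule frechet_derivative_at)
  then have "Ck_on k S (\<lambda>x. frechet_derivative f (at x) v)" for v
    by (intro Ck_on_cong[OF assms(1) _ assms(3)[of v]]) simp
  then show ?thesis using assms(2) by (auto simp: differentiable_def)
qed

lemma Ck_on_SucD:
  assumes "Ck_on (Suc k) S f"
  shows "Ck_on k S f"
  using assms
proof (induction k arbitrary: f)
  case 0
  then show ?case
    by (auto intro!: continuous_at_imp_continuous_on differentiable_imp_continuous_within)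
next
  case (Suc k)
  show ?case
    unfolding Ck_on.simps(2)[of k] using Suc.IH Suc.prems by (metis Ck_on.simps(2))
qed

lemma Ck_on_const:
  assumes "open S"
  shows "Ck_on k S (\<lambda>_. c)"
proof (induction k arbitrary: c)
  case 0
  then show ?case by simp
next
  case (Suc k)
  show ?case by (rule Ck_on_SucI[OF assms has_derivative_const Suc])
qed

lemma Ck_on_add:
  assumes "open S" "Ck_on k S f" "Ck_on k S g"
  shows "Ck_on k S (\<lambda>x. f x + g x)"
  using assms(2,3)
proof (induction k arbitrary: f g)
  case 0
  then show ?case by (simp add: continuous_on_add)
next
  case (Suc k)
  show ?case
  proof (rule Ck_on_SucI[OF assms(1)])
    fix x assume "x \<in> S"
    with Suc.prems show "((\<lambda>x. f x + g x) has_derivative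
      (\<lambda>v. frechet_derivative f (at x) v + frechet_derivative g (at x) v)) (at x)"
      by (intro has_derivative_add) (simp_all add: frechet_derivative_works[symmetric])
  next
    show "Ck_on k S (\<lambda>x. frechet_derivative f (at x) v + frechet_derivative g (at x) v)" for v
      using Suc.prems by (intro Suc.IH) simp_all
  qed
qed

lemma Ck_on_mult:
  fixes f g :: "'a::euclidean_space \<Rightarrow> real"
  assumes "open S" "Ck_on k S f" "Ck_on k S g"
  shows "Ck_on k S (\<lambda>x. f x * g x)"
  using assms(2,3)
proof (induction k arbitrary: f g)
  case 0
  then show ?case by (auto intro: continuous_intros)
next
  case (Suc k)
  show ?case
  proof (rule Ck_on_SucI[OF assms(1)])
    fix x assume "x \<in> S"
    with Suc.prems show "((\<lambda>x. f x * g x) has_derivative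
      (\<lambda>v. f x * frechet_derivative g (at x) v + frechet_derivative f (at x) v * g x)) (at x)"
      by (intro has_derivative_mult) (simp_all add: frechet_derivative_works[symmetric])
  next
    show "Ck_on k S (\<lambda>x. f x * frechet_derivative g (at x) v + frechet_derivative f (at x) v * g x)" for v
      \<comment> \<open>The product rule brings back the undifferentiated factors, which have to be
        lowered to order \<open>k\<close> before the induction hypothesis applies.\<close>
      using Suc.prems Ck_on_SucD[OF Suc.prems(1)] Ck_on_SucD[OF Suc.prems(2)]
      by (intro Ck_on_add Suc.IH assms(1)) simp_all
  qed
qed

text \<open>The derivative of \<open>inverse\<close> is a product of a constant and copies of
  \<open>inverse\<close> itself, so the induction closes.\<close>

lemma Ck_on_inverse:
  assumes "open S" "0 \<notin> S"
  shows "Ck_on k S (inverse :: real \<Rightarrow> real)"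
proof (induction k)
  case 0
  then show ?case using assms by (auto intro!: continuous_intros)
next
  case (Suc k)
  show ?case
  proof (rule Ck_on_SucI[OF assms(1)])
    fix x assume "x \<in> S"
    then show "(inverse has_derivative (\<lambda>v. - v * (inverse x * inverse x))) (at x)"
      using assms(2) by (auto intro!: derivative_eq_intros)
  next
    show "Ck_on k S (\<lambda>x. - v * (inverse x * inverse x))" for v
      by (intro Ck_on_mult Ck_on_const Suc assms(1))
  qed
qed

text \<open>Linear maps are their own derivatives, so differentiating along \<open>v\<close> gives
  an expression of the same shape, with \<open>f\<close> replaced by its derivative along
  \<open>L v\<close>. The lemma serves to transfer smoothness from a field to its coefficient
  functions, read off along a ray.\<close>

lemma Ck_on_linear_comp:
  fixes f :: "'b::euclidean_space \<Rightarrow> 'c::real_normed_vector"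
  assumes "open S" "L ` S \<subseteq> T" "bounded_linear L" "bounded_linear M" "Ck_on k T f"
  shows "Ck_on k S (\<lambda>x. M (f (L x)))"
  using assms(5)
proof (induction k arbitrary: f)
  case 0
  then have "continuous_on T f" by simp
  from continuous_on_compose2[OF this linear_continuous_on[OF assms(3)] assms(2)]
  have "continuous_on S (\<lambda>x. f (L x))" .
  then show ?case by (simp add: bounded_linear.continuous_on[OF assms(4)])
next
  case (Suc k)
  show ?case
  proof (rule Ck_on_SucI[OF assms(1)])
    fix x assume "x \<in> S"
    then have "(f has_derivative frechet_derivative f (at (L x))) (at (L x))"
      using Suc.prems assms(2) by (auto simp: frechet_derivative_works[symmetric])
    then show "((\<lambda>x. M (f (L x))) has_derivative (\<lambda>v. M (frechet_derivative f (at (L x)) (L v)))) (at x)"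
      using has_derivative_compose[OF bounded_linear_imp_has_derivative[OF assms(3)]]
        bounded_linear.has_derivative[OF assms(4)] by blast
  next
    show "Ck_on k S (\<lambda>x. M (frechet_derivative f (at (L x)) (L v)))" for v
      using Suc.prems by (intro Suc.IH) simp
  qed
qed

lemma smooth_on_has_derivative:
  "smooth_on S f \<Longrightarrow> x \<in> S \<Longrightarrow> (f has_derivative frechet_derivative f (at x)) (at x)"
  unfolding smooth_on_def by (drule spec[of _ "Suc 0"]) (simp add: frechet_derivative_works[symmetric])

section \<open>Regions and the cross product form of the fields\<close>

lemma open_region: "open R \<Longrightarrow> open (region R)"
  unfolding region_def using open_vimage[of R "\<lambda>p. norm (snd p)"]
  by (simp add: vimage_def continuous_on_norm continuous_on_snd)

text \<open>The field \<open>rot i\<close> is the cross product of the \<open>i\<close>-th basis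
  vector with position, by cyclic symmetry of the Levi-Civita symbol. From here on
  \<open>cross3\<close> replaces the index sums.\<close>

lemma sum_rot: "(\<Sum>i\<in>UNIV. (b $ i) *\<^sub>R rot i p) = (0, cross3 b (snd p))"
  by (auto simp: prod_eq_iff vec_eq_iff rot_def d_x_def levi_civita_def sum_3 forall_3 cross3_def axis_def
      fst_sum snd_sum algebra_simps)

lemma mem_bh_algebra_iff:
  "X \<in> bh_algebra \<longleftrightarrow> (\<exists>a b. X = (\<lambda>p. (a, cross3 b (snd p))))"
  by (auto simp: bh_algebra_def sum_rot d_t_def fun_eq_iff)

lemma has_bh_form_iff:
  "has_bh_form R V c N d f \<longleftrightarrow>
    smooth_on (R \<inter> {0<..}) c \<and> smooth_on (R \<inter> {0<..}) f \<and>
    (\<forall>p\<in>region R. V p =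
      (c (norm (snd p)) + N * fst p, cross3 d (snd p) + f (norm (snd p)) *\<^sub>R snd p))"
proof -
  have "(\<Sum>i\<in>UNIV. (s * x $ i) *\<^sub>R d_x i p) = (0, s *\<^sub>R x)" for s x p
    by (auto simp: prod_eq_iff vec_eq_iff d_x_def sum_3 forall_3 axis_def fst_sum snd_sum)
  then show ?thesis unfolding has_bh_form_def sum_rot by (simp add: d_t_def)
qed

text \<open>Links the index form of the first commutation condition to
  \<open>cross3\<close>.\<close>

lemma levi_civita_sum:
  "(\<Sum>i\<in>UNIV. \<Sum>j\<in>UNIV. a $ i * b $ j * levi_civita i j k) = cross3 a b $ k"
  using exhaust_3[of k] by (auto simp: levi_civita_def sum_3 cross3_def)

section \<open>Rotation invariant functions\<close>

text \<open>For \<open>r > 0\<close> the vectors \<open>cross3 w x\<close> fill the tangent space of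
  the sphere at \<open>x\<close>, so \<open>Z\<close> makes every tangential derivative vanish, and
  spheres in three dimensions are connected.\<close>

lemma constant_on_sphere:
  fixes g :: "real ^ 3 \<Rightarrow> real"
  assumes D: "\<And>x. norm x = r \<Longrightarrow> (g has_derivative g' x) (at x)"
    and Z: "\<And>x w. norm x = r \<Longrightarrow> g' x (cross3 w x) = 0"
    and xy: "norm x = r" "norm y = r"
  shows "g x = g y"
proof (cases "r = 0")
  case True
  then show ?thesis using xy by simp
next
  case False
  then have r: "r > 0" using xy by auto
  \<comment> \<open>Pulling \<open>g\<close> back along the radial projection moves the argument to the connected open set
    of nonzero vectors.\<close>
  define G :: "real ^ 3 \<Rightarrow> real ^ 3" where "G z = (r / norm z) *\<^sub>R z" for z
  have nG: "norm (G z) = r" if "z \<noteq> 0" for z using that r by (simp add: G_def)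
  have FD: "((\<lambda>z. g (G z)) has_derivative (\<lambda>_. 0)) (at z)" if z: "z \<in> - {0}" for z
  proof -
    have "G differentiable (at z)"
      unfolding G_def using z by (intro derivative_intros) auto
    then obtain G' where G': "(G has_derivative G') (at z)" by (auto simp: differentiable_def)
    \<comment> \<open>Since \<open>G\<close> has constant length, its derivative is tangent to the
      sphere.\<close>
    have "((\<lambda>z. G z \<bullet> G z) has_derivative (\<lambda>h. G z \<bullet> G' h + G' h \<bullet> G z)) (at z)"
      by (intro has_derivative_inner G')
    moreover have "((\<lambda>z. G z \<bullet> G z) has_derivative (\<lambda>h. 0)) (at z)"
      by (rule has_derivative_transform_within_open[of "\<lambda>_. r\<^sup>2" _ _ _ "- {0}"])
        (use z nG in \<open>auto simp: power2_norm_eq_inner[symmetric]\<close>)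
    ultimately have "(\<lambda>h. G z \<bullet> G' h + G' h \<bullet> G z) = (\<lambda>h. 0)"
      using has_derivative_unique by blast
    then have orth: "G z \<bullet> G' h = 0" for h
      by (metis inner_commute double_zero)
    \<comment> \<open>The axis comes from the double cross product: a vector \<open>u\<close>
      orthogonal to \<open>x\<close> equals \<open>cross3 (cross3 x u) x\<close> divided by the
      squared length of \<open>x\<close>.\<close>
    have "G' h = cross3 ((1 / r\<^sup>2) *\<^sub>R cross3 (G z) (G' h)) (G z)" for h
    proof -
      have "cross3 (cross3 (G z) (G' h)) (G z) = (G z \<bullet> G z) *\<^sub>R G' h - (G z \<bullet> G' h) *\<^sub>R G z"
        by (subst cross_skew) (simp add: Lagrange)
      then show ?thesis using orth nG[of z] z r by (simp add: power2_norm_eq_inner[symmetric] cross_mult_left)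
    qed
    then have "g' (G z) (G' h) = 0" for h using Z[of "G z"] nG[of z] z by (metis ComplD singletonI)
    then show ?thesis
      using has_derivative_compose[OF G' D[of "G z"]] nG[of z] z
      by auto
  qed
  have "connected (- {0 :: real ^ 3})" by (rule connected_punctured_universe) simp
  then have "g (G x) = g (G y)"
    using has_derivative_zero_unique_connected[of "- {0}" "\<lambda>z. g (G z)" x y] FD xy r by fastforce
  moreover have "G x = x" "G y = y" using xy r by (auto simp: G_def)
  ultimately show ?thesis by simp
qed

section \<open>Brackets with the symmetry algebra\<close>

interpretation cross: bounded_bilinear cross3
  using bilinear_cross by (simp add: bilinear_conv_bounded_bilinear)

lemma lie_bracket_affine:
  "lie_bracket V (\<lambda>p. (a, cross3 b (snd p))) p =
    (0, cross3 b (snd (V p))) - frechet_derivative V (at p) (a, cross3 b (snd p))"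
proof -
  have "((\<lambda>p. (a, cross3 b (snd p))) has_derivative (\<lambda>h. (0, cross3 b (snd h)))) (at p)"
    by (intro has_derivative_Pair has_derivative_const
        bounded_linear.has_derivative[OF cross.bounded_linear_right] has_derivative_snd has_derivative_ident)
  then show ?thesis by (simp add: lie_bracket_def frechet_derivative_at[symmetric])
qed

lemma vec3_expand: "(w :: real ^ 3) = (w $ 1) *\<^sub>R axis 1 1 + (w $ 2) *\<^sub>R axis 2 1 + (w $ 3) *\<^sub>R axis 3 1"
  by (simp add: vec_eq_iff forall_3 axis_def)

text \<open>The bracket is linear in the rotation axis \<open>w\<close>, so the elements of the algebra that it
  produces can be chosen to depend linearly on \<open>w\<close>.\<close>

lemma bracket_into_bh_algebraE:
  assumes V: "smooth_on (region R) V" and br: "bracket_into_bh_algebra R V"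
  obtains a b A and B :: "real ^ 3 \<Rightarrow> real ^ 3" where "linear A" "linear B"
    "\<And>p. p \<in> region R \<Longrightarrow> frechet_derivative V (at p) (1, 0) = (a, cross3 b (snd p))"
    "\<And>p w. p \<in> region R \<Longrightarrow> frechet_derivative V (at p) (0, cross3 w (snd p)) =
      (- A w, cross3 w (snd (V p)) - cross3 (B w) (snd p))"
proof -
  have ex: "\<exists>a' b'. \<forall>p\<in>region R. (0, cross3 b (snd (V p))) -
      frechet_derivative V (at p) (a, cross3 b (snd p)) = (a', cross3 b' (snd p))" for a b
    using br unfolding bracket_into_bh_algebra_def Ball_def Bex_def mem_bh_algebra_iff
    by (metis (mono_tags, lifting) lie_bracket_affine)
  obtain a b where ab: "\<And>p. p \<in> region R \<Longrightarrow> frechet_derivative V (at p) (1, 0) = (a, cross3 b (snd p))"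
  proof -
    obtain a' b' where "\<forall>p\<in>region R. (0, 0) - frechet_derivative V (at p) (1, 0) = (a', cross3 b' (snd p))"
      \<comment> \<open>Here \<open>b\<close> is \<open>0\<close> and \<open>a\<close> is
        \<open>1\<close>: the bracket with \<open>d_t\<close>.\<close>
      using ex[of 0 1] by auto
    then have "frechet_derivative V (at p) (1, 0) = (- a', cross3 (- b') (snd p))" if "p \<in> region R" for p
      using that by (auto simp: prod_eq_iff minus_equation_iff)
    then show ?thesis by (rule that)
  qed
  obtain \<alpha> \<beta> where \<alpha>\<beta>: "\<And>i p. p \<in> region R \<Longrightarrow> (0, cross3 (axis i 1) (snd (V p))) -
      frechet_derivative V (at p) (0, cross3 (axis i 1) (snd p)) = (\<alpha> i, cross3 (\<beta> i) (snd p))"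
    using ex[of "axis _ 1" 0] by metis
  \<comment> \<open>Witnesses are chosen for the three basis axes only and extended linearly, so
    linearity holds by construction.\<close>
  define A where "A w = w $ 1 * \<alpha> 1 + w $ 2 * \<alpha> 2 + w $ 3 * \<alpha> 3" for w :: "real ^ 3"
  define B where "B w = (w $ 1) *\<^sub>R \<beta> 1 + (w $ 2) *\<^sub>R \<beta> 2 + (w $ 3) *\<^sub>R \<beta> 3" for w :: "real ^ 3"
  have lin: "linear A" "linear B"
    unfolding A_def B_def by (auto intro!: linearI simp: algebra_simps)
  have "frechet_derivative V (at p) (0, cross3 w (snd p)) =
      (- A w, cross3 w (snd (V p)) - cross3 (B w) (snd p))" if p: "p \<in> region R" for p w
  proof -
    define \<Phi> where "\<Phi> w = (0, cross3 w (snd (V p))) - frechet_derivative V (at p) (0, cross3 w (snd p))" for w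
    have "linear (frechet_derivative V (at p))"
      using smooth_on_has_derivative[OF V p] has_derivative_linear by blast
    then have "linear (\<lambda>w. frechet_derivative V (at p) (0, cross3 w (snd p)))"
      by (rule linear_compose[unfolded o_def, rotated])
        (auto intro!: linearI simp: cross.add_left cross.scaleR_left)
    then have "linear \<Phi>"
      unfolding \<Phi>_def
      by (intro linear_compose_sub) (auto intro!: linearI simp: cross.add_left cross.scaleR_left)
    then have "\<Phi> w = (w $ 1) *\<^sub>R \<Phi> (axis 1 1) + (w $ 2) *\<^sub>R \<Phi> (axis 2 1) + (w $ 3) *\<^sub>R \<Phi> (axis 3 1)"
      by (subst vec3_expand) (simp only: linear_add linear_scale)
    also have "\<dots> = (A w, cross3 (B w) (snd p))"
      using \<alpha>\<beta>[OF p] by (simp add: \<Phi>_def A_def B_def cross.add_left cross.scaleR_left)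
    finally show ?thesis by (simp add: \<Phi>_def prod_eq_iff algebra_simps)
  qed
  with that lin ab show ?thesis by blast
qed

text \<open>With \<open>x\<close> and \<open>w\<close> distinct basis vectors, the components of
  \<open>H\<close> orthogonal to \<open>x\<close> say that one diagonal entry of \<open>B\<close> is
  the sum of the other two and that one pair of off-diagonal entries is antisymmetric. All cases
  together force a zero diagonal and antisymmetry.\<close>

lemma linear_eq_cross3:
  fixes B :: "real ^ 3 \<Rightarrow> real ^ 3"
  assumes B: "linear B"
    and H: "\<And>i w. let x = axis i 1 in cross3 x (B (cross3 w x) - cross3 w (B x) - cross3 (B w) x) = 0"
  shows "\<exists>m. \<forall>w. B w = cross3 m w"
proof -
  let ?e = "\<lambda>i. axis i 1 :: real ^ 3"
  have comps: "(?e i) $ j = (if i = j then 1 else 0)" for i j by (auto simp: axis_def)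
  have neg: "B (- w) = - B w" for w using B by (rule linear_neg)
  note h = H[of 1 "?e 2"] H[of 1 "?e 3"] H[of 2 "?e 1"] H[of 2 "?e 3"] H[of 3 "?e 1"] H[of 3 "?e 2"]
  note h' = h[unfolded Let_def cross_basis neg]
  have *: "B (?e 1) $ 1 = 0" "B (?e 2) $ 2 = 0" "B (?e 3) $ 3 = 0"
    "B (?e 1) $ 2 = - B (?e 2) $ 1" "B (?e 1) $ 3 = - B (?e 3) $ 1" "B (?e 2) $ 3 = - B (?e 3) $ 2"
    using h' by (simp_all add: vec_eq_iff forall_3 cross_components comps)
  \<comment> \<open>The axial vector of the antisymmetric matrix of \<open>B\<close>.\<close>
  have "B w = cross3 (vector [B (?e 2) $ 3, B (?e 3) $ 1, B (?e 1) $ 2]) w" for w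
  proof -
    have "B w = (w $ 1) *\<^sub>R B (?e 1) + (w $ 2) *\<^sub>R B (?e 2) + (w $ 3) *\<^sub>R B (?e 3)"
      by (subst vec3_expand) (simp only: linear_add[OF B] linear_scale[OF B])
    then show ?thesis
      using * by (simp add: vec_eq_iff forall_3 cross_components)
  qed
  then show ?thesis by blast
qed

lemma cross3_eq_0_imp_parallel:
  assumes "cross3 x y = 0" "x \<noteq> 0"
  shows "y = ((x \<bullet> y) / (x \<bullet> x)) *\<^sub>R x"
proof -
  have "(x \<bullet> x) *\<^sub>R y = (x \<bullet> y) *\<^sub>R x"
    using Lagrange[of x x y] assms by simp
  then have "inverse (x \<bullet> x) *\<^sub>R (x \<bullet> x) *\<^sub>R y = inverse (x \<bullet> x) *\<^sub>R (x \<bullet> y) *\<^sub>R x"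
    by simp
  then show ?thesis using assms by (simp add: divide_inverse_commute)
qed

section \<open>Determination of the admissible fields\<close>

lemma bracket_imp_bh_form:
  assumes R: "open R" "R \<inter> {0<..} \<noteq> {}"
    and V: "smooth_on (region R) V" and br: "bracket_into_bh_algebra R V"
  shows "\<exists>c N d f. has_bh_form R V c N d f"
proof -
  obtain a b A and B :: "real ^ 3 \<Rightarrow> real ^ 3" where lin: "linear A" "linear B" and
    Dt: "\<And>p. p \<in> region R \<Longrightarrow> frechet_derivative V (at p) (1, 0) = (a, cross3 b (snd p))" and
    Dr: "\<And>p w. p \<in> region R \<Longrightarrow> frechet_derivative V (at p) (0, cross3 w (snd p)) =
      (- A w, cross3 w (snd (V p)) - cross3 (B w) (snd p))"
    by (rule bracket_into_bh_algebraE[OF V br]) (rule that)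
  obtain r where r: "r \<in> R" "r > 0" using R by auto
  have DV: "(V has_derivative frechet_derivative V (at p)) (at p)" if "p \<in> region R" for p
    using smooth_on_has_derivative[OF V that] .
  have reg: "(t, x) \<in> region R \<longleftrightarrow> norm x \<in> R" for t x by (simp add: region_def)
  \<comment> \<open>At \<open>x\<close> the rotation about the axis \<open>x\<close> itself vanishes, so derivatives of \<open>V\<close> drop out.\<close>
  have *: "A (snd p) = 0" "cross3 (snd p) (snd (V p)) = cross3 (B (snd p)) (snd p)"
    if "p \<in> region R" for p
    using Dr[OF that, of "snd p"] linear_0[OF has_derivative_linear[OF DV[OF that]]]
    by (auto simp: prod_eq_iff zero_prod_def)
  have A0: "A w = 0" for w
  proof (cases "w = 0")
    case True
    then show ?thesis using lin linear_0 by blast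
  next
    case False
    \<comment> \<open>Rescaling moves \<open>w\<close> to the admissible radius \<open>r\<close>;
      linearity of \<open>A\<close> removes the factor again.\<close>
    then have "A ((r / norm w) *\<^sub>R w) = 0" using *(1)[of "(0, (r / norm w) *\<^sub>R w)"] r by (simp add: reg)
    then show ?thesis using False r by (simp add: linear_scale[OF lin(1)])
  qed
  have Vt: "V (t, x) = V (0, x) + t *\<^sub>R (a, cross3 b x)" if "norm x \<in> R" for t x
  proof -
    \<comment> \<open>The time derivative of \<open>V\<close> given by \<open>Dt\<close> does not
      depend on \<open>t\<close>, so \<open>V\<close> is affine along each time line.\<close>
    have "((\<lambda>t. V (t, x) - t *\<^sub>R (a, cross3 b x)) has_derivative (\<lambda>_. 0)) (at t)" for t
    proof -
      have "((\<lambda>t. (t, x)) has_derivative (\<lambda>h. (h, 0))) (at t)"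
        by (intro has_derivative_Pair has_derivative_ident has_derivative_const)
      from has_derivative_compose[OF this DV] that
      have "((\<lambda>t. V (t, x)) has_derivative (\<lambda>h. frechet_derivative V (at (t, x)) (h, 0))) (at t)"
        by (simp add: reg)
      moreover have "frechet_derivative V (at (t, x)) (h, 0) = h *\<^sub>R (a, cross3 b x)" for h
        using linear_scale[OF has_derivative_linear[OF DV[of "(t, x)"]], of h "(1, 0)"] Dt[of "(t, x)"] that
        by (simp add: reg)
      ultimately have "((\<lambda>t. V (t, x)) has_derivative (\<lambda>h. h *\<^sub>R (a, cross3 b x))) (at t)" by simp
      from has_derivative_diff[OF this bounded_linear_imp_has_derivative[OF bounded_linear_scaleR_left[of "(a, cross3 b x)"]]]
      show ?thesis by simp
    qed
    from has_derivative_zero_unique_connected[of UNIV, OF _ _ this, of t 0]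
    show ?thesis by (simp add: algebra_simps zero_prod_def[symmetric])
  qed
  have b0: "b = 0"
  proof -
    \<comment> \<open>The cross product of \<open>x\<close> with the spatial part of
      \<open>V\<close> is fixed by \<open>B\<close> and \<open>x\<close>, hence independent of time.
      The part of \<open>V\<close> linear in \<open>t\<close> must therefore be parallel to
      \<open>x\<close>.\<close>
    have bx: "cross3 x (cross3 b x) = 0" if "norm x \<in> R" for x
    proof -
      have "cross3 x (snd (V (1, x))) = cross3 x (snd (V (0, x)))"
        using *(2)[of "(0, x)"] *(2)[of "(1, x)"] that by (simp add: reg)
      then show ?thesis using Vt[OF that, of 1] by (simp add: cross.add_right)
    qed
    have "cross3 (axis i 1) (cross3 b (axis i 1)) = 0" for i
      using bx[of "r *\<^sub>R axis i 1"] r by (simp add: cross.scaleR_left cross.scaleR_right norm_axis_1)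
    from this[of 1] this[of 2] show ?thesis
      by (simp add: vec_eq_iff forall_3 cross_components axis_def)
  qed
  have "\<exists>m. \<forall>w. B w = cross3 m w"
  proof (rule linear_eq_cross3[OF lin(2)], unfold Let_def)
    fix i w
    define x :: "real ^ 3" where "x = r *\<^sub>R axis i 1"
    define p where "p = (0 :: real, x)"
    define v where "v = snd (V p)"
    define h where "h = cross3 w x"
    have x: "norm x \<in> R" "x \<noteq> 0" "snd p = x" and p: "p \<in> region R"
      using r by (simp_all add: x_def p_def reg norm_axis_1)
    \<comment> \<open>The function \<open>x \<times> (v + B x)\<close> vanishes identically, so its two derivatives agree.\<close>
    have D1: "((\<lambda>p. cross3 (snd p) (snd (V p) + B (snd p))) has_derivative
        (\<lambda>h. cross3 (snd p) (snd (frechet_derivative V (at p) h) + B (snd h))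
          + cross3 (snd h) (snd (V p) + B (snd p)))) (at p)"
      by (intro cross.FDERIV has_derivative_add has_derivative_snd DV p has_derivative_ident
          bounded_linear.has_derivative[OF linear_conv_bounded_linear[THEN iffD1, OF lin(2)]])
    have D2: "((\<lambda>p. cross3 (snd p) (snd (V p) + B (snd p))) has_derivative (\<lambda>_. 0)) (at p)"
    proof (rule has_derivative_transform_within_open[OF has_derivative_const open_region[OF R(1)] p])
      fix q assume "q \<in> region R"
      then show "0 = cross3 (snd q) (snd (V q) + B (snd q))"
        using *(2) by (simp add: cross.add_right) (metis cross_skew add.right_inverse)
    qed
    have 1: "cross3 x (cross3 w v - cross3 (B w) x + B h) + cross3 h (v + B x) = 0"
      using fun_cong[OF has_derivative_unique[OF D1 D2], of "(0, h)"] Dr[OF p, of w]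
      by (simp add: x v_def h_def)
    have "cross3 x (v + B x) = 0"
      using *(2)[OF p] by (simp add: cross.add_right x v_def cross_skew[of x "B x"])
    then obtain l where "v + B x = l *\<^sub>R x" using cross3_eq_0_imp_parallel x by blast
    then have v: "v = l *\<^sub>R x - B x" and v': "v + B x = l *\<^sub>R x" by (simp_all add: algebra_simps)
    \<comment> \<open>The terms with \<open>l\<close> cancel because \<open>h\<close> is
      \<open>cross3 w x\<close>, and what is left constrains \<open>B\<close> alone.\<close>
    have "cross3 x (B h - cross3 w (B x) - cross3 (B w) x) = 0"
      using 1 unfolding v' unfolding v h_def
      by (simp add: cross.add_right cross.diff_right cross.scaleR_right cross_skew[of "cross3 w x" x] algebra_simps)
    then have "(r * r) *\<^sub>R cross3 (axis i 1) (B (cross3 w (axis i 1)) - cross3 w (B (axis i 1)) -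
        cross3 (B w) (axis i 1)) = 0"
      by (simp add: h_def x_def cross.scaleR_left cross.scaleR_right linear_scale[OF lin(2)]
          cross.add_right cross.diff_right algebra_simps)
    then show "cross3 (axis i 1) (B (cross3 w (axis i 1)) - cross3 w (B (axis i 1)) -
        cross3 (B w) (axis i 1)) = 0"
      using r by simp
  qed
  then obtain m where m: "\<And>w. B w = cross3 m w" by blast
  \<comment> \<open>Any unit vector would do: the radial functions are sampled along its ray. The
    division by \<open>s\<close> in \<open>f\<close> is smooth at positive radii; \<open>f 0\<close>
    is \<open>0\<close> by the convention for \<open>inverse\<close>, which is harmless since
    \<open>f\<close> multiplies the position.\<close>
  define e :: "real ^ 3" where "e = axis 1 1"
  define c where "c s = fst (V (0, s *\<^sub>R e))" for s
  define f where "f s = (e \<bullet> snd (V (0, s *\<^sub>R e))) * inverse s" for s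
  have e: "norm e = 1" "e \<bullet> e = 1" by (simp_all add: e_def norm_axis_1 inner_axis_axis)
  have DV0: "((\<lambda>x. V (0, x)) has_derivative (\<lambda>h. frechet_derivative V (at (0, x)) (0, h))) (at x)"
    if "norm x \<in> R" for x
    using that by (intro has_derivative_compose[OF _ DV, of "\<lambda>x. (0, x)" "\<lambda>h. (0, h)"])
      (auto simp: reg intro!: has_derivative_Pair)
  have c: "fst (V (0, x)) = c (norm x)" if x: "norm x \<in> R" for x
    unfolding c_def
  proof (rule constant_on_sphere[where g = "\<lambda>x. fst (V (0, x))" and r = "norm x"])
    fix y :: "real ^ 3" assume y: "norm y = norm x"
    show "((\<lambda>x. fst (V (0, x))) has_derivative (\<lambda>h. fst (frechet_derivative V (at (0, y)) (0, h)))) (at y)"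
      using DV0 x y by (intro has_derivative_fst) simp
    show "fst (frechet_derivative V (at (0, y)) (0, cross3 w y)) = 0" for w
      using Dr[of "(0, y)" w] x y A0 by (simp add: reg)
  qed (simp_all add: e)
  have rad: "x \<bullet> snd (V (0, x)) = f (norm x) * (x \<bullet> x)" if x: "norm x \<in> R" "x \<noteq> 0" for x
  proof -
    have "x \<bullet> snd (V (0, x)) = (norm x *\<^sub>R e) \<bullet> snd (V (0, norm x *\<^sub>R e))"
    proof (rule constant_on_sphere[where g = "\<lambda>x. x \<bullet> snd (V (0, x))" and r = "norm x"])
      fix y :: "real ^ 3" assume y: "norm y = norm x"
      show "((\<lambda>x. x \<bullet> snd (V (0, x))) has_derivative
          (\<lambda>h. y \<bullet> snd (frechet_derivative V (at (0, y)) (0, h)) + h \<bullet> snd (V (0, y)))) (at y)"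
        using DV0 x y by (intro has_derivative_inner has_derivative_snd has_derivative_ident) simp
      \<comment> \<open>The two triple products with the spatial part of \<open>V\<close> cancel,
        and \<open>cross3 (B w) y\<close> is orthogonal to \<open>y\<close>.\<close>
      show "y \<bullet> snd (frechet_derivative V (at (0, y)) (0, cross3 w y)) + cross3 w y \<bullet> snd (V (0, y)) = 0" for w
        using Dr[of "(0, y)" w] x y cross_triple[of w y "snd (V (0, y))"]
        by (simp add: reg inner_diff_right dot_cross_self cross_triple[of y w] inner_commute)
          (simp add: cross3_simps)
    qed (simp_all add: e)
    then show ?thesis using x by (simp add: f_def dot_square_norm power2_eq_square)
  qed
  have sp: "snd (V (0, x)) = cross3 (- m) x + f (norm x) *\<^sub>R x" if x: "norm x \<in> R" for x
  proof (cases "x = 0")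
    case True
    \<comment> \<open>All rotation fields vanish at the origin, so \<open>Dr\<close> leaves only
      this term there.\<close>
    have "cross3 w (snd (V (0, x))) = 0" for w
      using Dr[of "(0, x)" w] x True linear_0[OF has_derivative_linear[OF DV[of "(0, x)"]]]
      by (simp add: reg prod_eq_iff zero_prod_def)
    then have "snd (V (0, x)) = 0" using cross_basis_nonzero cross_skew by (metis neg_equal_0_iff_equal)
    then show ?thesis using True by simp
  next
    case False
    \<comment> \<open>A vector is determined by its cross and inner products with a nonzero
      \<open>x\<close>.\<close>
    have "cross3 x (snd (V (0, x))) = cross3 x (cross3 (- m) x + f (norm x) *\<^sub>R x)"
      using *(2)[of "(0, x)"] x m
      by (simp add: reg cross.diff_right cross.scaleR_right cross_skew[of x "cross3 m x"])
    moreover have "x \<bullet> snd (V (0, x)) = x \<bullet> (cross3 (- m) x + f (norm x) *\<^sub>R x)"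
      using rad[OF x False] by (simp add: inner_add_right inner_diff_right dot_cross_self)
    ultimately show ?thesis using cross_dot_cancel False by blast
  qed
  have S: "open (R \<inter> {0<..})" using R by (intro open_Int) auto
  have L: "(\<lambda>s :: real. (0 :: real, s *\<^sub>R e)) ` (R \<inter> {0<..}) \<subseteq> region R"
    "bounded_linear (\<lambda>s :: real. (0 :: real, s *\<^sub>R e))"
    by (auto simp: reg e intro!: bounded_linear_Pair bounded_linear_zero bounded_linear_scaleR_left)
  have "smooth_on (R \<inter> {0<..}) c"
    using V unfolding smooth_on_def c_def
    by (auto intro: Ck_on_linear_comp[OF S L bounded_linear_fst])
  moreover have "smooth_on (R \<inter> {0<..}) f"
    using V unfolding smooth_on_def f_def
    by (auto intro!: Ck_on_mult Ck_on_inverse S Ck_on_linear_comp[OF S L, where M = "\<lambda>q. e \<bullet> snd q"]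
        bounded_linear_compose[OF bounded_linear_inner_right bounded_linear_snd])
  moreover have "V p = (c (norm (snd p)) + a * fst p, cross3 (- m) (snd p) + f (norm (snd p)) *\<^sub>R snd p)"
    if "p \<in> region R" for p
    using Vt[of "snd p" "fst p"] c[of "snd p"] sp[of "snd p"] that b0
    by (simp add: region_def prod_eq_iff algebra_simps)
  ultimately show ?thesis unfolding has_bh_form_iff by blast
qed

section \<open>Brackets of two fields of the given form\<close>

lemma smooth_on_deriv:
  fixes f :: "real \<Rightarrow> real"
  assumes "smooth_on S f" "s \<in> S"
  shows "(f has_derivative (\<lambda>h. h * deriv f s)) (at s)"
proof -
  have "f differentiable (at s)"
    using smooth_on_has_derivative[OF assms] by (auto simp: differentiable_def)
  then have "(f has_field_derivative deriv f s) (at s)"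
    by (simp add: DERIV_deriv_iff_real_differentiable)
  then show ?thesis by (simp add: has_field_derivative_def mult_commute_abs)
qed

lemma has_derivative_radial:
  fixes g :: "real \<Rightarrow> real" and x :: "'a::real_inner"
  assumes "smooth_on S g" "norm x \<in> S" "x \<noteq> 0"
  shows "((\<lambda>y. g (norm y)) has_derivative (\<lambda>h. deriv g (norm x) * (x \<bullet> h) / norm x)) (at x)"
  using has_derivative_compose[OF has_derivative_norm[OF assms(3)] smooth_on_deriv[OF assms(1,2)]]
  by (simp add: sgn_div_norm inner_commute divide_inverse mult_ac)

lemma has_bh_form_derivative:
  assumes R: "open R" and V: "has_bh_form R V c N d f"
    and x: "norm x \<in> R" "x \<noteq> 0"
  shows "(V has_derivative (\<lambda>h. (deriv c (norm x) * (x \<bullet> snd h) / norm x + N * fst h,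
      cross3 d (snd h) + (f (norm x) *\<^sub>R snd h + (deriv f (norm x) * (x \<bullet> snd h) / norm x) *\<^sub>R x))))
    (at (t, x))"
proof -
  let ?S = "R \<inter> {0<..}"
  have S: "norm x \<in> ?S" "smooth_on ?S c" "smooth_on ?S f" using x V by (auto simp: has_bh_form_def)
  have rad: "((\<lambda>p. g (norm (snd p))) has_derivative (\<lambda>h. deriv g (norm x) * (x \<bullet> snd h) / norm x)) (at (t, x))"
    if "smooth_on ?S g" for g
    using has_derivative_compose[OF bounded_linear_imp_has_derivative[OF bounded_linear_snd],
        of "\<lambda>y. g (norm y)" _ "(t, x)"] has_derivative_radial[OF that S(1) x(2)] by simp
  have "((\<lambda>p. (c (norm (snd p)) + N * fst p, cross3 d (snd p) + f (norm (snd p)) *\<^sub>R snd p)) has_derivative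
      (\<lambda>h. (deriv c (norm x) * (x \<bullet> snd h) / norm x + N * fst h,
        cross3 d (snd h) + (f (norm (snd (t, x))) *\<^sub>R snd h + (deriv f (norm x) * (x \<bullet> snd h) / norm x) *\<^sub>R snd (t, x)))))
      (at (t, x))"
    by (intro has_derivative_Pair has_derivative_add has_derivative_mult_right has_derivative_scaleR
        has_derivative_fst has_derivative_snd has_derivative_ident rad S
        bounded_linear.has_derivative[OF cross.bounded_linear_right])
  then have "((\<lambda>p. (c (norm (snd p)) + N * fst p, cross3 d (snd p) + f (norm (snd p)) *\<^sub>R snd p)) has_derivative
      (\<lambda>h. (deriv c (norm x) * (x \<bullet> snd h) / norm x + N * fst h,
        cross3 d (snd h) + (f (norm x) *\<^sub>R snd h + (deriv f (norm x) * (x \<bullet> snd h) / norm x) *\<^sub>R x))))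
      (at (t, x))" by simp
  then show ?thesis
    by (rule has_derivative_transform_within_open[OF _ open_region[OF R]])
      (use x V in \<open>auto simp: has_bh_form_iff region_def\<close>)
qed

lemma euler_radial_eq:
  assumes "smooth_on S c" "norm x \<in> S" "x \<noteq> 0"
  shows "euler_radial c x = deriv c (norm x) * norm x"
proof -
  have "euler_radial c x = (\<Sum>j\<in>UNIV. x $ j * (deriv c (norm x) * (x \<bullet> axis j 1) / norm x))"
    unfolding euler_radial_def frechet_derivative_at[OF has_derivative_radial[OF assms], symmetric] ..
  also have "\<dots> = deriv c (norm x) / norm x * (x \<bullet> x)"
    unfolding inner_axis by (simp add: inner_vec_def sum_distrib_left mult_ac)
  finally show ?thesis using assms(3) by (simp add: dot_square_norm power2_eq_square)
qed

text \<open>Rotations commute with radial fields and annihilate radial functions, so the mixed terms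
  drop out. The terms \<open>N * N' * t\<close> cancel in the time component.\<close>

lemma lie_bracket_bh_form:
  assumes R: "open R" and V: "has_bh_form R V c N d f" and W: "has_bh_form R W c' N' d' f'"
    and x: "norm x \<in> R" "x \<noteq> 0"
  shows "lie_bracket V W (t, x) =
    ((f (norm x) * euler_radial c' x - N * c' (norm x)) - (f' (norm x) * euler_radial c x - N' * c (norm x)),
     cross3 (cross3 d' d) x
      + (norm x * (f (norm x) * deriv f' (norm x) - deriv f (norm x) * f' (norm x))) *\<^sub>R x)"
proof -
  let ?S = "R \<inter> {0<..}"
  let ?r = "norm x"
  have S: "norm x \<in> ?S" "smooth_on ?S c" "smooth_on ?S c'" using x V W by (auto simp: has_bh_form_def)
  note er = euler_radial_eq[OF S(2,1) x(2)] euler_radial_eq[OF S(3,1) x(2)]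
  have Vx: "V (t, x) = (c ?r + N * t, cross3 d x + f ?r *\<^sub>R x)"
    "W (t, x) = (c' ?r + N' * t, cross3 d' x + f' ?r *\<^sub>R x)"
    using V W x by (auto simp: has_bh_form_iff region_def)
  have xx: "x \<bullet> (cross3 a x + k *\<^sub>R x) / ?r = k * ?r" for a k
    using x by (simp add: inner_add_right dot_cross_self dot_square_norm power2_eq_square)
  \<comment> \<open>The Jacobi identity for the cross product.\<close>
  have J: "cross3 (cross3 d' d) x = cross3 d' (cross3 d x) - cross3 d (cross3 d' x)"
    by (simp add: cross3_simps forall_3)
  show ?thesis
    unfolding lie_bracket_def er J frechet_derivative_at[OF has_bh_form_derivative[OF R V x], symmetric]
      frechet_derivative_at[OF has_bh_form_derivative[OF R W x], symmetric] Vx fst_conv snd_conv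
      times_divide_eq_right[symmetric] xx
    by (simp add: cross.add_right cross.scaleR_right algebra_simps)
qed

lemma lie_bracket_bh_form_center:
  assumes V: "smooth_on (region R) V" "has_bh_form R V c N d f"
    and W: "smooth_on (region R) W" "has_bh_form R W c' N' d' f'"
    and R: "0 \<in> R"
  shows "lie_bracket V W (t, 0) = (N' * c 0 - N * c' 0, 0)"
proof -
  have reg: "(u, 0) \<in> region R" for u using R by (simp add: region_def)
  have D: "frechet_derivative X (at (t, 0)) (s, 0) = (K * s, 0)"
    if X: "smooth_on (region R) X" "has_bh_form R X k K e g" for X k K e g s
  proof -
    have "((\<lambda>u. (u, 0 :: real ^ 3)) has_derivative (\<lambda>h. (h, 0))) (at t)"
      by (intro has_derivative_Pair has_derivative_ident has_derivative_const)
    from has_derivative_compose[OF this smooth_on_has_derivative[OF X(1) reg]]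
    have 1: "((\<lambda>u. X (u, 0)) has_derivative (\<lambda>h. frechet_derivative X (at (t, 0)) (h, 0))) (at t)" .
    have "(\<lambda>u. X (u, 0)) = (\<lambda>u. (k 0 + K * u, 0))"
      using X(2) reg by (auto simp: has_bh_form_iff)
    moreover have "((\<lambda>u. (k 0 + K * u, 0 :: real ^ 3)) has_derivative (\<lambda>h. (0 + K * h, 0))) (at t)"
      by (intro has_derivative_Pair has_derivative_add has_derivative_const has_derivative_mult_right has_derivative_ident)
    ultimately have "((\<lambda>u. X (u, 0)) has_derivative (\<lambda>h. (0 + K * h, 0))) (at t)" by simp
    from fun_cong[OF has_derivative_unique[OF 1 this], of s] show ?thesis by simp
  qed
  have "V (t, 0) = (c 0 + N * t, 0)" "W (t, 0) = (c' 0 + N' * t, 0)"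
    using V(2) W(2) reg by (auto simp: has_bh_form_iff)
  then show ?thesis by (simp add: lie_bracket_def D[OF V] D[OF W] algebra_simps)
qed

lemma bh_form_commute_iff:
  assumes R: "open R" "R \<inter> {0<..} \<noteq> {}"
    and V: "smooth_on (region R) V" "has_bh_form R V c N d f"
    and W: "smooth_on (region R) W" "has_bh_form R W c' N' d' f'"
  shows "(\<forall>p\<in>region R. lie_bracket V W p = 0) \<longleftrightarrow>
      cross3 d d' = 0
    \<and> (\<forall>x. norm x \<in> R \<longrightarrow>
        (f (norm x) * euler_radial c' x - N * c' (norm x)) - (f' (norm x) * euler_radial c x - N' * c (norm x)) = 0)
    \<and> (\<forall>r\<in>R. r > 0 \<longrightarrow> f r * deriv f' r - deriv f r * f' r = 0)"
    (is "?L \<longleftrightarrow> ?A \<and> (\<forall>x. norm x \<in> R \<longrightarrow> ?T x = 0) \<and> (\<forall>r\<in>R. r > 0 \<longrightarrow> ?W r = 0)")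
proof -
  have B: "lie_bracket V W (t, x) = (?T x, cross3 (cross3 d' d) x + (norm x * ?W (norm x)) *\<^sub>R x)"
    if "norm x \<in> R" for t x
  proof (cases "x = 0")
    case True
    then show ?thesis
      \<comment> \<open>As \<open>euler_radial\<close> is \<open>0\<close> at the origin, the
        formula for nonzero \<open>x\<close> also covers the center.\<close>
      using lie_bracket_bh_form_center[OF V W, of t] that by (simp add: euler_radial_def)
  next
    case False
    then show ?thesis by (rule lie_bracket_bh_form[OF R(1) V(2) W(2) that])
  qed
  have L: "?L \<longleftrightarrow> (\<forall>x. norm x \<in> R \<longrightarrow> ?T x = 0 \<and> cross3 (cross3 d' d) x + (norm x * ?W (norm x)) *\<^sub>R x = 0)"
    using B by (auto simp: region_def zero_prod_def)
  \<comment> \<open>The tangential and the radial part are orthogonal, so pairing with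
    \<open>x\<close> isolates \<open>k\<close>.\<close>
  have split: "cross3 a x = 0 \<and> k = 0" if "cross3 a x + (norm x * k) *\<^sub>R x = 0" "x \<noteq> 0" for a x k
  proof -
    have "x \<bullet> (cross3 a x + (norm x * k) *\<^sub>R x) = 0" using that by simp
    then have "k = 0" using that(2) by (simp add: inner_add_right dot_cross_self)
    then show ?thesis using that by simp
  qed
  show ?thesis
  proof
    assume ?L
    then have T: "?T x = 0" and X: "x \<noteq> 0 \<Longrightarrow> cross3 (cross3 d' d) x = 0 \<and> ?W (norm x) = 0"
      if "norm x \<in> R" for x
      using L that split[of "cross3 d' d" x "?W (norm x)"] by blast+
    obtain r where r: "r \<in> R" "r > 0" using R by auto
    \<comment> \<open>One sphere of admissible radius suffices: its points on the axes already force
      the constant vector \<open>cross3 d' d\<close> to vanish.\<close>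
    have "cross3 (cross3 d' d) (axis i 1) = 0" for i
      using X[of "r *\<^sub>R axis i 1"] r by (simp add: norm_axis_1 cross.scaleR_right)
    then have "?A" using cross_basis_nonzero cross_skew by (metis neg_equal_0_iff_equal)
    moreover have "?W s = 0" if "s \<in> R" "s > 0" for s
      using X[of "s *\<^sub>R axis 1 1"] that by (simp add: norm_axis_1)
    ultimately show "?A \<and> (\<forall>x. norm x \<in> R \<longrightarrow> ?T x = 0) \<and> (\<forall>r\<in>R. r > 0 \<longrightarrow> ?W r = 0)"
      using T by blast
  next
    assume H: "?A \<and> (\<forall>x. norm x \<in> R \<longrightarrow> ?T x = 0) \<and> (\<forall>r\<in>R. r > 0 \<longrightarrow> ?W r = 0)"
    then have "cross3 d' d = 0" using cross_skew by (metis neg_equal_0_iff_equal)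
    moreover have "norm x * ?W (norm x) = 0" if "norm x \<in> R" for x :: "real ^ 3"
      using H that by (cases "x = 0") auto
    ultimately show ?L using L H by simp
  qed
qed

theorem mainTheorem8:
  fixes R :: "real set"
  assumes "open R" and "R \<inter> {0<..} \<noteq> {}"
  shows
    "(\<forall>V. smooth_on (region R) V \<longrightarrow> bracket_into_bh_algebra R V \<longrightarrow>
        (\<exists>c N d f. has_bh_form R V c N d f))
     \<and>
     (\<forall>V\<^sub>a V\<^sub>b c\<^sub>a N\<^sub>a d\<^sub>a f\<^sub>a c\<^sub>b N\<^sub>b d\<^sub>b f\<^sub>b.
        smooth_on (region R) V\<^sub>a \<longrightarrow> smooth_on (region R) V\<^sub>b \<longrightarrow>
        has_bh_form R V\<^sub>a c\<^sub>a N\<^sub>a d\<^sub>a f\<^sub>a \<longrightarrow> has_bh_form R V\<^sub>b c\<^sub>b N\<^sub>b d\<^sub>b f\<^sub>b \<longrightarrow>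
        ((\<forall>p\<in>region R. lie_bracket V\<^sub>a V\<^sub>b p = 0) \<longleftrightarrow>
           (\<forall>k. (\<Sum>i\<in>UNIV. \<Sum>j\<in>UNIV. d\<^sub>a $ i * d\<^sub>b $ j * levi_civita i j k) = 0)
         \<and> (\<forall>x. norm x \<in> R \<longrightarrow>
              (f\<^sub>a (norm x) * euler_radial c\<^sub>b x - N\<^sub>a * c\<^sub>b (norm x))
            - (f\<^sub>b (norm x) * euler_radial c\<^sub>a x - N\<^sub>b * c\<^sub>a (norm x)) = 0)
         \<and> (\<forall>r\<in>R. r > 0 \<longrightarrow> f\<^sub>a r * deriv f\<^sub>b r - deriv f\<^sub>a r * f\<^sub>b r = 0)))"
  using bracket_imp_bh_form[OF assms] bh_form_commute_iff[OF assms]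
  by (simp add: levi_civita_sum vec_eq_iff[of "cross3 _ _" 0])

end
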